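(* Let $K$ be any complex bi-quadratic field with ring of integers $\mathcal{O}_K$. Then every element of $4\mathcal{O}_K=\{4\beta:\beta\in\mathcal{O}_K\}$ can be written as a sum of five squares of elements of $\mathcal{O}_K$.
   Context: A complex bi-quadratic field is a number field of the form $\mathbb{Q}(\sqrt{a},\sqrt{b})$ of degree $4$ over $\mathbb{Q}$ (with $a,b$ square-free integers) which is not totally real, i.e. which contains an imaginary quadratic subfield. *)

theory Defs
  imports
    "HOL-Algebra.Algebraic_Closure_Type"
    "HOL-Algebra.Generated_Fields"
    "HOL-Algebra.Embedded_Algebras"
begin

text \<open>
  Number fields are subsets of an arbitrary ambient field type of characteristic 0. The ambient
  type, viewed as an HOL-Algebra record, is \<open>ring_of_type_algebra\<close>; the prime field is
  \<open>\<rat>\<close>, the range of the embedding of the type \<open>rat\<close>.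
\<close>

abbreviation ambient :: "'a::field_char_0 ring"
  where "ambient \<equiv> ring_of_type_algebra"

definition embeddings :: "'a::field_char_0 set \<Rightarrow> ('a \<Rightarrow> complex) set"
  where "embeddings K = ring_hom (ambient\<lparr>carrier := K\<rparr>) ambient"

definition totally_real :: "'a::field_char_0 set \<Rightarrow> bool"
  where "totally_real K \<longleftrightarrow> (\<forall>\<sigma>\<in>embeddings K. \<sigma> ` K \<subseteq> \<real>)"

definition ring_of_integers :: "'a::field_char_0 set \<Rightarrow> 'a set"
  where "ring_of_integers K = {x \<in> K. algebraic_int x}"

text \<open>
  The square roots are elements \<open>\<alpha>\<close> and \<open>\<beta>\<close> of the ambient field; choosing the opposite sign of
  either does not change the generated field. \<open>ring.dimension ambient n \<rat> K\<close> says that \<open>K\<close> has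
  dimension exactly \<open>n\<close> as a vector space over \<open>\<rat>\<close>.
\<close>

definition biquadratic_field :: "'a::field_char_0 set \<Rightarrow> bool"
  where "biquadratic_field K \<longleftrightarrow>
    (\<exists>(a::int) (b::int) \<alpha> \<beta>. squarefree a \<and> squarefree b \<and>
       \<alpha>^2 = of_int a \<and> \<beta>^2 = of_int b \<and> K = generate_field ambient {\<alpha>, \<beta>}) \<and>
    ring.dimension ambient 4 \<rat> K"

definition complex_biquadratic_field :: "'a::field_char_0 set \<Rightarrow> bool"
  where "complex_biquadratic_field K \<longleftrightarrow> biquadratic_field K \<and> \<not> totally_real K"

end

theory Submission
  imports Defs "Jordan_Normal_Form.Char_Poly"
begin

text \<open>Let \<open>\<alpha>\<^sup>2 = a\<close> with \<open>a < 0\<close> squarefree; such an \<open>\<alpha>\<close> exists in \<open>K\<close> because otherwise every embedding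
  would be real. By Lagrange, \<open>- a = x\<^sub>1\<^sup>2 + \<dots> + x\<^sub>4\<^sup>2\<close>, so \<open>l = (\<alpha>, x\<^sub>1, \<dots>, x\<^sub>4)\<close> is an isotropic
  vector for the sum of five squares, and squarefreeness of \<open>a\<close> makes the \<open>x\<^sub>i\<close> coprime, say
  \<open>\<Sum> c\<^sub>i x\<^sub>i = 1\<close>. With \<open>n = \<Sum> c\<^sub>i\<^sup>2\<close> the vector \<open>m = 2 (0, c\<^sub>1, \<dots>, c\<^sub>4) - n l\<close> is isotropic too and
  \<open>l \<bullet> m = 2\<close>, hence the squares of the entries of \<open>\<beta> l + m\<close> sum up to \<open>4 \<beta>\<close>.\<close>

subsection \<open>Lagrange's four-square theorem\<close>

definition sum4sq :: "int \<Rightarrow> bool"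
  where "sum4sq n \<longleftrightarrow> (\<exists>a b c d. n = a^2 + b^2 + c^2 + d^2)"

text \<open>Multiplicativity of the quaternion norm, applied to \<open>x\<close> times the conjugate
  of \<open>y\<close>. This sign pattern puts the inner product into the first bracket, so that all
  four brackets become divisible by \<open>m\<close> in the descent, where x_i and y_i are
  congruent.\<close>

lemma euler_four_square:
  fixes x1 :: "'a::comm_ring_1"
  shows "(x1^2 + x2^2 + x3^2 + x4^2) * (y1^2 + y2^2 + y3^2 + y4^2) =
    (x1*y1 + x2*y2 + x3*y3 + x4*y4)^2 + (x1*y2 - x2*y1 + x3*y4 - x4*y3)^2 +
    (x1*y3 - x3*y1 + x4*y2 - x2*y4)^2 + (x1*y4 - x4*y1 + x2*y3 - x3*y2)^2"
  by (simp add: power2_eq_square algebra_simps)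

lemma sum4sq_mult: "sum4sq m \<Longrightarrow> sum4sq n \<Longrightarrow> sum4sq (m * n)"
  unfolding sum4sq_def using euler_four_square by metis

text \<open>Division of \<open>m - 2 * x\<close> by \<open>2 * m\<close> leaves
  \<open>r = m - 2 * y\<close>, and the range of the remainder is the half-open interval claimed for
  \<open>2 * y\<close>.\<close>

lemma centered_residue:
  fixes m x :: int
  assumes "m > 0"
  obtains y k where "x = y + m * k" "- m < 2 * y" "2 * y \<le> m"
proof
  define q where "q = (m - 2 * x) div (2 * m)"
  define r where "r = (m - 2 * x) mod (2 * m)"
  have "m - 2 * x = 2 * m * q + r" "0 \<le> r" "r < 2 * m"
    using assms by (simp_all add: q_def r_def)
  then show "x = (x + m * q) + m * (- q)" "- m < 2 * (x + m * q)" "2 * (x + m * q) \<le> m"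
    by (simp_all add: algebra_simps)
qed

text \<open>Fermat descent: reduce the x_i to centered residues y_i modulo \<open>m\<close>, whose
  squares sum to \<open>m * r\<close> with r \<le> m. Euler's identity writes
  \<open>(m * p) * (m * r)\<close> as four squares of multiples of \<open>m\<close>; cancelling
  \<open>m^2\<close> represents \<open>r * p\<close>.\<close>

lemma four_square_descent:
  fixes p m :: int
  assumes p: "prime p" and m: "1 < m" "m < p" and sq: "sum4sq (m * p)"
  shows "\<exists>r. 0 < r \<and> r < m \<and> sum4sq (r * p)"
proof -
  obtain x1 x2 x3 x4 where x: "m * p = x1^2 + x2^2 + x3^2 + x4^2"
    using sq unfolding sum4sq_def by blast
  \<comment> \<open>Both extreme cases r = 0 and r = m will contradict this: \<open>m\<close> lies
    strictly between 1 and the prime \<open>p\<close>, so it cannot divide \<open>p\<close>.\<close>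
  have ndvd: "\<not> m * m dvd m * p"
  proof
    assume "m * m dvd m * p"
    then have "m dvd p" using m by simp
    moreover have "\<forall>k. 0 \<le> k \<and> k dvd p \<longrightarrow> k = 1 \<or> k = p" using p prime_int_iff by blast
    moreover have "0 \<le> m" using m by simp
    ultimately have "m = 1 \<or> m = p" by blast
    then show False using m by simp
  qed
  obtain y1 k1 where 1: "x1 = y1 + m * k1" "- m < 2 * y1" "2 * y1 \<le> m"
    using centered_residue[of m x1] m by auto
  obtain y2 k2 where 2: "x2 = y2 + m * k2" "- m < 2 * y2" "2 * y2 \<le> m"
    using centered_residue[of m x2] m by auto
  obtain y3 k3 where 3: "x3 = y3 + m * k3" "- m < 2 * y3" "2 * y3 \<le> m"
    using centered_residue[of m x3] m by auto
  obtain y4 k4 where 4: "x4 = y4 + m * k4" "- m < 2 * y4" "2 * y4 \<le> m"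
    using centered_residue[of m x4] m by auto
  define Y where "Y = y1^2 + y2^2 + y3^2 + y4^2"
  \<comment> \<open>The quotient of \<open>Y\<close> by \<open>m\<close>, read off from
    \<open>m * p\<close> after substituting x_i = y_i + m k_i.\<close>
  define r where "r = p - 2 * (k1*y1 + k2*y2 + k3*y3 + k4*y4) - m * (k1^2 + k2^2 + k3^2 + k4^2)"
  have Y: "Y = m * r"
    using x unfolding 1(1) 2(1) 3(1) 4(1) r_def Y_def by (simp add: power2_eq_square algebra_simps)
  \<comment> \<open>In the equality clause the strict lower bound rules out
    \<open>2 * y = - m\<close>.\<close>
  have bnd: "4 * y^2 \<le> m^2 \<and> (4 * y^2 = m^2 \<longrightarrow> 2 * y = m)" if "- m < 2 * y" "2 * y \<le> m" for y :: int
  proof -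
    have eq: "m^2 - 4 * y^2 = (m - 2 * y) * (m + 2 * y)"
      by (simp add: power2_eq_square algebra_simps)
    moreover have "(m - 2 * y) * (m + 2 * y) \<ge> 0"
      using that by (intro mult_nonneg_nonneg) auto
    ultimately have "4 * y^2 \<le> m^2" by linarith
    moreover have "2 * y = m" if "4 * y^2 = m^2"
    proof -
      have "(m - 2 * y) * (m + 2 * y) = 0" using that eq by linarith
      then show ?thesis using \<open>- m < 2 * y\<close> by simp
    qed
    ultimately show ?thesis by blast
  qed
  note bnds = bnd[OF 1(2,3)] bnd[OF 2(2,3)] bnd[OF 3(2,3)] bnd[OF 4(2,3)]
  have "0 \<le> m * r"
    unfolding Y[symmetric] Y_def by simp
  then have "r \<ge> 0"
    using m by (simp add: zero_le_mult_iff)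
  have "4 * y1^2 \<le> m^2" "4 * y2^2 \<le> m^2" "4 * y3^2 \<le> m^2" "4 * y4^2 \<le> m^2"
    using bnds by simp_all
  note bnd_le = this
  then have "4 * Y \<le> 4 * m^2"
    unfolding Y_def distrib_left by linarith
  then have "r \<le> m"
    using m unfolding Y by (simp add: power2_eq_square)
  have "r \<noteq> 0"
  proof
    assume "r = 0"
    then have "y1^2 + y2^2 + y3^2 + y4^2 = 0" using Y unfolding Y_def by simp
    then have "y1 = 0" "y2 = 0" "y3 = 0" "y4 = 0"
      using zero_le_power2[of y1] zero_le_power2[of y2] zero_le_power2[of y3] zero_le_power2[of y4]
      by (simp_all add: add_nonneg_eq_0_iff)
    then have "m * p = (m * m) * (k1^2 + k2^2 + k3^2 + k4^2)"
      unfolding x 1(1) 2(1) 3(1) 4(1) by (simp add: power2_eq_square algebra_simps)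
    then show False using ndvd by (metis dvd_triv_left)
  qed
  have "r \<noteq> m"
  proof
    assume "r = m"
    then have "4 * Y = 4 * m^2" by (simp add: Y power2_eq_square)
    then have "4 * y1^2 = m^2" "4 * y2^2 = m^2" "4 * y3^2 = m^2" "4 * y4^2 = m^2"
      using bnd_le unfolding Y_def distrib_left by linarith+
    then have "2 * y1 = m" "2 * y2 = m" "2 * y3 = m" "2 * y4 = m"
      using bnds by simp_all
    \<comment> \<open>All bounds are attained, so every y_i is m/2. Each square is then m^2 (1/4 +
      k_i + k_i^2), and the four quarters add up to 1.\<close>
    then have "y2 = y1" "y3 = y1" "y4 = y1" "m = 2 * y1" by auto
    then have "m * p = (m * m) * (1 + k1 * (k1 + 1) + k2 * (k2 + 1) + k3 * (k3 + 1) + k4 * (k4 + 1))"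
      unfolding x 1(1) 2(1) 3(1) 4(1) by (simp add: power2_eq_square algebra_simps)
    then show False using ndvd by (metis dvd_triv_left)
  qed
  \<comment> \<open>The brackets of Euler's identity divided by \<open>m\<close>: the first is
    \<open>Y\<close> plus \<open>m\<close> times the sum of the k_i y_i, and in the other three the
    products of two y's cancel.\<close>
  define w1 where "w1 = r + (k1*y1 + k2*y2 + k3*y3 + k4*y4)"
  define w2 where "w2 = k1*y2 - k2*y1 + k3*y4 - k4*y3"
  define w3 where "w3 = k1*y3 - k3*y1 + k4*y2 - k2*y4"
  define w4 where "w4 = k1*y4 - k4*y1 + k2*y3 - k3*y2"
  have w: "x1*y1 + x2*y2 + x3*y3 + x4*y4 = m * w1" "x1*y2 - x2*y1 + x3*y4 - x4*y3 = m * w2"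
    "x1*y3 - x3*y1 + x4*y2 - x2*y4 = m * w3" "x1*y4 - x4*y1 + x2*y3 - x3*y2 = m * w4"
    using Y unfolding Y_def 1(1) 2(1) 3(1) 4(1) w1_def w2_def w3_def w4_def
    by (simp_all add: power2_eq_square algebra_simps)
  have "(m * p) * Y = (m * w1)^2 + (m * w2)^2 + (m * w3)^2 + (m * w4)^2"
    unfolding x Y_def w[symmetric] by (rule euler_four_square)
  then have "m^2 * (r * p) = m^2 * (w1^2 + w2^2 + w3^2 + w4^2)"
    unfolding Y by (simp add: power2_eq_square algebra_simps)
  then have "r * p = w1^2 + w2^2 + w3^2 + w4^2"
    using m by simp
  then show ?thesis
    using \<open>r \<ge> 0\<close> \<open>r \<le> m\<close> \<open>r \<noteq> 0\<close> \<open>r \<noteq> m\<close> unfolding sum4sq_def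
    by (intro exI[of _ r]) auto
qed

text \<open>Pigeonhole: for arguments in 0..h with p = 2h + 1, the residues of a^2 and of -1 - b^2
  form two sets of size h + 1 each, too many to be disjoint among p residues. Since a, b \<le> h <
  p/2, the sum a^2 + b^2 + 1 stays below p^2, whence m < p.\<close>

lemma odd_prime_dvd_two_squares_plus_one:
  fixes p :: int
  assumes p: "prime p" "odd p"
  obtains a b m where "a^2 + b^2 + 1 = m * p" "0 < m" "m < p"
proof -
  obtain h where h: "p = 2 * h + 1" using p(2) by (auto elim: oddE)
  have p2: "p \<ge> 2" using p prime_ge_2_int by blast
  have "h \<ge> 1" using h p2 by linarith
  define f where "f = (\<lambda>x::int. x^2 mod p)"
  define g where "g = (\<lambda>x::int. (- 1 - x^2) mod p)"
  \<comment> \<open>Neither \<open>x - y\<close> nor \<open>x + y\<close> can be a nonzero multiple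
    of \<open>p\<close>, as both are at most 2h = p - 1 in absolute value; and
    \<open>x + y = 0\<close> forces both to be 0.\<close>
  have key: "x = y" if "p dvd x^2 - y^2" "x \<in> {0..h}" "y \<in> {0..h}" for x y
  proof -
    have "x^2 - y^2 = (x - y) * (x + y)" by (simp add: power2_eq_square algebra_simps)
    then have "p dvd x - y \<or> p dvd x + y"
      using that(1) p(1) by (simp add: prime_dvd_mult_iff)
    moreover have "\<bar>x - y\<bar> < p" "\<bar>x + y\<bar> < p" using that h by auto
    ultimately have "x - y = 0 \<or> x + y = 0"
      using dvd_imp_le_int[of "x - y" p] dvd_imp_le_int[of "x + y" p] by fastforce
    then show "x = y" using that by auto
  qed
  have "inj_on f {0..h}"
    by (rule inj_onI, rule key) (auto simp: f_def mod_eq_dvd_iff)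
  moreover have "inj_on g {0..h}"
  proof (rule inj_onI)
    fix x y assume "x \<in> {0..h}" "y \<in> {0..h}" "g x = g y"
    moreover from \<open>g x = g y\<close> have "p dvd y^2 - x^2"
      by (simp add: g_def mod_eq_dvd_iff)
    ultimately show "x = y" using key by metis
  qed
  ultimately have "card (f ` {0..h}) = nat (h + 1)" "card (g ` {0..h}) = nat (h + 1)"
    by (simp_all add: card_image)
  moreover have "f ` {0..h} \<union> g ` {0..h} \<subseteq> {0..<p}"
    using p2 by (auto simp: f_def g_def)
  then have "card (f ` {0..h} \<union> g ` {0..h}) \<le> card {0..<p}"
    by (intro card_mono) auto
  then have "card (f ` {0..h} \<union> g ` {0..h}) \<le> nat p" by simp
  ultimately have "card (f ` {0..h} \<union> g ` {0..h}) < card (f ` {0..h}) + card (g ` {0..h})"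
    using h \<open>h \<ge> 1\<close> by linarith
  then have "f ` {0..h} \<inter> g ` {0..h} \<noteq> {}"
    using card_Un_disjoint[of "f ` {0..h}" "g ` {0..h}"] by force
  then obtain a b where ab: "a \<in> {0..h}" "b \<in> {0..h}" "a^2 mod p = (- 1 - b^2) mod p"
    unfolding f_def g_def by blast
  then have "p dvd a^2 - (- 1 - b^2)" by (simp only: mod_eq_dvd_iff)
  then have "p dvd a^2 + b^2 + 1" by (simp add: algebra_simps)
  then obtain m where m: "a^2 + b^2 + 1 = m * p" by (metis dvdE mult.commute)
  have "a^2 \<le> h^2" "b^2 \<le> h^2" using ab by (auto intro: power_mono)
  moreover have "p * p = 4 * h^2 + 4 * h + 1" using h by (simp add: power2_eq_square algebra_simps)
  then have "2 * h^2 + 1 < p * p" using \<open>h \<ge> 1\<close> zero_le_power2[of h] by linarith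
  ultimately have "m * p < p * p" using m by linarith
  then have "m < p" using p2 by simp
  moreover have "m * p > 0" using m zero_le_power2[of a] zero_le_power2[of b] by linarith
  then have "m > 0" using p2 by (simp add: zero_less_mult_iff)
  ultimately show thesis using m that by blast
qed

section \<open>From descent to primes and to all nonnegative integers\<close>

lemma sum4sq_multiple_imp_sum4sq_prime:
  fixes p m :: int
  assumes "prime p" "0 < m" "m < p" "sum4sq (m * p)"
  shows "sum4sq p"
  using assms
proof (induction "nat m" arbitrary: m rule: less_induct)
  case less
  show ?case
  proof (cases "m = 1")
    case True
    with less.prems show ?thesis by simp
  next
    case False
    then obtain r where "0 < r" "r < m" "sum4sq (r * p)"
      using four_square_descent[of p m] less.prems by force
    then show ?thesis using less.hyps[of r] less.prems by simp
  qed
qed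

lemma sum4sq_prime:
  assumes "prime (p::int)"
  shows "sum4sq p"
proof (cases "odd p")
  case True
  then obtain a b m where "a^2 + b^2 + 1 = m * p" "0 < m" "m < p"
    using odd_prime_dvd_two_squares_plus_one assms by metis
  moreover from this have "m * p = a^2 + b^2 + 1^2 + 0^2" by simp
  then have "sum4sq (m * p)" unfolding sum4sq_def by blast
  ultimately show ?thesis using sum4sq_multiple_imp_sum4sq_prime assms by blast
next
  case False
  then have "p = 2" using assms
    by (metis prime_int_numeral_eq two_is_prime_nat primes_dvd_imp_eq)
  then have "p = 1^2 + 1^2 + 0^2 + 0^2" by simp
  then show ?thesis unfolding sum4sq_def by blast
qed

text \<open>Induction along the prime factorization, with Euler's identity for products.
  Nonnegativity is carried along: it excludes the unit -1 and passes from \<open>p * x\<close> to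
  \<open>x\<close>.\<close>

theorem lagrange_four_squares:
  fixes n :: int
  assumes "n \<ge> 0"
  obtains a b c d where "n = a^2 + b^2 + c^2 + d^2"
proof -
  have "sum4sq n" using assms
  proof (induction n rule: prime_divisors_induct)
    case zero
    have "(0::int) = 0^2 + 0^2 + 0^2 + 0^2" by simp
    then show ?case unfolding sum4sq_def by blast
  next
    case (unit x)
    then have "x = 1^2 + 0^2 + 0^2 + 0^2" by auto
    then show ?case unfolding sum4sq_def by blast
  next
    case (factor p x)
    then have "x \<ge> 0" using prime_gt_0_int[of p] by (auto simp: zero_le_mult_iff)
    then show ?case using factor sum4sq_prime sum4sq_mult by blast
  qed
  then show thesis using that unfolding sum4sq_def by blast
qed

subsection \<open>The ring of algebraic integers\<close>

text \<open>The Z-module generated by a finite \<open>S\<close>. For infinite \<open>S\<close> the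
  sum defaults to 0, so the span collapses to the zero module.\<close>

definition int_span :: "'a::comm_ring_1 set \<Rightarrow> 'a set"
  where "int_span S = {x. \<exists>c. x = (\<Sum>s\<in>S. of_int (c s) * s)}"

section \<open>Closure properties of integer spans\<close>

lemma int_spanI: "x = (\<Sum>s\<in>S. of_int (c s) * s) \<Longrightarrow> x \<in> int_span S"
  unfolding int_span_def by (rule CollectI, rule exI)

lemma int_span_add: "x \<in> int_span S \<Longrightarrow> y \<in> int_span S \<Longrightarrow> x + y \<in> int_span S"
proof -
  assume "x \<in> int_span S" "y \<in> int_span S"
  then obtain c d where "x = (\<Sum>s\<in>S. of_int (c s) * s)" "y = (\<Sum>s\<in>S. of_int (d s) * s)"
    unfolding int_span_def by blast
  then have "x + y = (\<Sum>s\<in>S. of_int (c s + d s) * s)"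
    by (simp add: sum.distrib algebra_simps)
  then show ?thesis by (rule int_spanI)
qed

lemma int_span_scale: "x \<in> int_span S \<Longrightarrow> of_int k * x \<in> int_span S"
proof -
  assume "x \<in> int_span S"
  then obtain c where "x = (\<Sum>s\<in>S. of_int (c s) * s)"
    unfolding int_span_def by blast
  then have "of_int k * x = (\<Sum>s\<in>S. of_int (k * c s) * s)"
    by (simp add: sum_distrib_left mult.assoc)
  then show ?thesis by (rule int_spanI)
qed

lemma int_span_base:
  assumes "finite S" "s \<in> S"
  shows "s \<in> int_span S"
proof -
  have "s = (\<Sum>t\<in>S. of_int (if t = s then 1 else 0) * t)"
    using assms by (simp add: if_distrib[of of_int] if_distrib[of "\<lambda>c. c * _"] cong: if_cong)
  then show ?thesis by (rule int_spanI)
qed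

lemma int_span_zero: "0 \<in> int_span S"
  by (rule int_spanI[where c = "\<lambda>_. 0"]) simp

lemma int_span_sum:
  "(\<And>i. i \<in> I \<Longrightarrow> f i \<in> int_span S) \<Longrightarrow> sum f I \<in> int_span S"
  by (induction I rule: infinite_finite_induct) (auto intro: int_span_zero int_span_add)

text \<open>By linearity, stability under \<open>x\<close> passes from the generators to the whole
  span; this allows two stable multiplications to be composed.\<close>

lemma int_span_mult_closed:
  assumes "\<And>s. s \<in> S \<Longrightarrow> x * s \<in> int_span S" "y \<in> int_span S"
  shows "x * y \<in> int_span S"
proof -
  obtain c where "y = (\<Sum>s\<in>S. of_int (c s) * s)"
    using assms(2) unfolding int_span_def by blast
  then have "x * y = (\<Sum>s\<in>S. of_int (c s) * (x * s))"
    by (simp add: sum_distrib_left mult_ac)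
  then show ?thesis using assms(1) by (auto intro: int_span_sum int_span_scale)
qed

text \<open>The determinant trick: \<open>x\<close> is an eigenvalue of the integer matrix of multiplication by
  \<open>x\<close> on the generators.\<close>

lemma algebraic_int_if_stable_span:
  fixes x :: "'a::field_char_0"
  assumes S: "finite S" "s0 \<in> S" "s0 \<noteq> 0" and stable: "\<And>s. s \<in> S \<Longrightarrow> x * s \<in> int_span S"
  shows "algebraic_int x"
proof -
  obtain c where c: "\<And>s. s \<in> S \<Longrightarrow> x * s = (\<Sum>t\<in>S. of_int (c s t) * t)"
    using stable unfolding int_span_def mem_Collect_eq by metis
  obtain vs where vs: "set vs = S" "distinct vs"
    using finite_distinct_list[OF S(1)] by blast
  define N where "N = length vs"
  define A :: "int mat" where "A = mat N N (\<lambda>(i, j). c (vs ! i) (vs ! j))"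
  define B :: "'a mat" where "B = map_mat of_int A"
  define v where "v = vec N (\<lambda>i. vs ! i)"
  have A: "A \<in> carrier_mat N N" and B: "B \<in> carrier_mat N N"
    by (simp_all add: A_def B_def)
  have bij: "bij_betw ((!) vs) {0..<N} S"
    using bij_betw_nth[OF vs(2)] vs(1) by (simp add: N_def atLeast0LessThan)
  have "B *\<^sub>v v = x \<cdot>\<^sub>v v"
  proof (rule eq_vecI)
    fix i assume "i < dim_vec (x \<cdot>\<^sub>v v)"
    then have i: "i < N" by (simp add: v_def)
    then have "(B *\<^sub>v v) $ i = (\<Sum>j = 0..<N. of_int (c (vs ! i) (vs ! j)) * vs ! j)"
      by (simp add: A_def B_def v_def scalar_prod_def)
    also have "\<dots> = (\<Sum>t\<in>S. of_int (c (vs ! i) t) * t)"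
      by (rule sum.reindex_bij_betw[OF bij])
    also have "\<dots> = x * vs ! i"
      using c[of "vs ! i"] i vs(1) by (metis N_def nth_mem)
    finally show "(B *\<^sub>v v) $ i = (x \<cdot>\<^sub>v v) $ i"
      using i by (simp add: v_def)
  qed (simp add: A_def B_def v_def)
  \<comment> \<open>An eigenvector must be nonzero; the generator \<open>s0\<close> guarantees
    this.\<close>
  moreover have "v \<noteq> 0\<^sub>v N"
  proof -
    obtain i where "i < N" "vs ! i = s0"
      using S(2) vs(1) by (metis N_def in_set_conv_nth)
    then show ?thesis using S(3) by (metis index_vec index_zero_vec(1) v_def)
  qed
  ultimately have "eigenvalue B x"
    using B unfolding eigenvalue_def eigenvector_def by (intro exI[of _ v]) (auto simp: v_def)
  then have "poly (char_poly B) x = 0"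
    using eigenvalue_root_char_poly[OF B] by simp
  \<comment> \<open>Characteristic polynomials commute with the coercion from the integers, so
    \<open>x\<close> is a root of the monic integer polynomial \<open>char_poly A\<close>.\<close>
  then have "poly (map_poly of_int (char_poly A)) x = 0"
    unfolding B_def using of_int_hom.char_poly_hom[OF A] by metis
  moreover have "lead_coeff (char_poly A) = 1"
    using degree_monic_char_poly[OF A] by simp
  ultimately show ?thesis
    unfolding algebraic_int_altdef_ipoly by blast
qed

lemma algebraic_int_power_reduction:
  fixes x :: "'a::field_char_0"
  assumes "algebraic_int x"
  obtains n c where "n > 0" "x ^ n = (\<Sum>i<n. of_int (c i) * x ^ i)"
proof -
  obtain p where p: "poly (map_poly of_int p) x = 0" "lead_coeff p = 1"
    using assms unfolding algebraic_int_altdef_ipoly by blast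
  define n where "n = degree p"
  have "0 = (\<Sum>i\<le>n. of_int (coeff p i) * x ^ i)"
    using p(1) unfolding n_def by (simp add: poly_altdef degree_map_poly coeff_map_poly)
  also have "{..n} = insert n {..<n}" by auto
  finally have e: "x ^ n = (\<Sum>i<n. of_int (- coeff p i) * x ^ i)"
    using p(2) by (simp add: n_def sum_negf eq_neg_iff_add_eq_0)
  \<comment> \<open>For \<open>n = 0\<close> the relation would read 1 = 0.\<close>
  have "n > 0" by (rule gr0I) (use e in simp)
  from this e show thesis by (rule that)
qed

text \<open>The monomials x^i y^j with exponents below the degrees of monic relations for
  \<open>x\<close> and \<open>y\<close> generate such a module: multiplication by \<open>x\<close>
  or \<open>y\<close> either stays in range or reaches x^n or y^m, which the relation rewrites in
  lower powers.\<close>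

lemma algebraic_int_common_stable_span:
  fixes x y :: "'a::field_char_0"
  assumes "algebraic_int x" "algebraic_int y"
  obtains S where "finite S" "1 \<in> S"
    "\<And>s. s \<in> S \<Longrightarrow> x * s \<in> int_span S" "\<And>s. s \<in> S \<Longrightarrow> y * s \<in> int_span S"
proof -
  obtain n c where n: "n > 0" "x ^ n = (\<Sum>i<n. of_int (c i) * x ^ i)"
    using algebraic_int_power_reduction[OF assms(1)] .
  obtain m d where m: "m > 0" "y ^ m = (\<Sum>i<m. of_int (d i) * y ^ i)"
    using algebraic_int_power_reduction[OF assms(2)] .
  define S where "S = (\<lambda>(i, j). x ^ i * y ^ j) ` ({..<n} \<times> {..<m})"
  have fin: "finite S" by (simp add: S_def)
  have mem: "x ^ i * y ^ j \<in> int_span S" if "i < n" "j < m" for i j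
    using that by (intro int_span_base[OF fin]) (auto simp: S_def)
  show thesis
  proof
    show "finite S" by (fact fin)
    \<comment> \<open>Since \<open>n\<close> and \<open>m\<close> are positive, the exponent pair
      (0, 0) is in range; it provides the nonzero generator 1.\<close>
    have "(\<lambda>(i, j). x ^ i * y ^ j) (0, 0) \<in> S"
      unfolding S_def using n(1) m(1) by (intro imageI) auto
    then show "1 \<in> S" by simp
  next
    fix s assume "s \<in> S"
    then obtain i j where ij: "i < n" "j < m" "s = x ^ i * y ^ j" by (auto simp: S_def)
    have "x * s = x ^ Suc i * y ^ j" by (simp add: ij(3))
    also have "\<dots> \<in> int_span S"
    proof (cases "Suc i < n")
      case True
      then show ?thesis using mem ij(2) by blast
    next
      case False
      then have "Suc i = n" using ij(1) by simp
      then have "x ^ Suc i * y ^ j = (\<Sum>i<n. of_int (c i) * (x ^ i * y ^ j))"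
        by (simp only: n(2) sum_distrib_right mult.assoc)
      then show ?thesis using mem ij(2) by (auto intro!: int_span_sum int_span_scale)
    qed
    finally show "x * s \<in> int_span S" .
    have "y * s = x ^ i * y ^ Suc j" by (simp add: ij(3))
    also have "\<dots> \<in> int_span S"
    proof (cases "Suc j < m")
      case True
      then show ?thesis using mem ij(1) by blast
    next
      case False
      then have "Suc j = m" using ij(2) by simp
      then have "x ^ i * y ^ Suc j = (\<Sum>j<m. of_int (d j) * (x ^ i * y ^ j))"
        by (simp only: m(2) sum_distrib_left mult.left_commute)
      then show ?thesis using mem ij(1) by (auto intro!: int_span_sum int_span_scale)
    qed
    finally show "y * s \<in> int_span S" .
  qed
qed

text \<open>A module stable under both \<open>x\<close> and \<open>y\<close> is stable under their
  sum and product, so the determinant trick applies to each.\<close>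

lemma
  fixes x y :: "'a::field_char_0"
  assumes "algebraic_int x" "algebraic_int y"
  shows algebraic_int_add: "algebraic_int (x + y)"
    and algebraic_int_mult: "algebraic_int (x * y)"
proof -
  obtain S where S: "finite S" "1 \<in> S"
    "\<And>s. s \<in> S \<Longrightarrow> x * s \<in> int_span S" "\<And>s. s \<in> S \<Longrightarrow> y * s \<in> int_span S"
    using algebraic_int_common_stable_span[OF assms] by blast
  show "algebraic_int (x + y)"
    using S by (intro algebraic_int_if_stable_span[OF S(1,2)]) (auto simp: distrib_right intro: int_span_add)
  have "x * y * s \<in> int_span S" if "s \<in> S" for s
    using int_span_mult_closed[OF S(3) S(4)[OF that]] by (simp add: mult.assoc)
  then show "algebraic_int (x * y)"
    by (intro algebraic_int_if_stable_span[OF S(1,2)]) auto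
qed

subsection \<open>Subfields and their embeddings\<close>

lemma ambient_simps [simp]:
  "carrier ambient = UNIV" "monoid.mult ambient = (*)" "monoid.one ambient = 1" "ring.zero ambient = 0" "ring.add ambient = (+)"
  by (simp_all add: ring_of_type_algebra_def)

section \<open>Closure properties of subfields and their rings of integers\<close>

lemma subfield_closed:
  fixes K :: "'a::field_char_0 set"
  assumes "subfield K ambient"
  shows "x \<in> K \<Longrightarrow> y \<in> K \<Longrightarrow> x + y \<in> K" "x \<in> K \<Longrightarrow> y \<in> K \<Longrightarrow> x * y \<in> K"
    "x \<in> K \<Longrightarrow> - x \<in> K" "of_int k \<in> K"
proof -
  have sr: "subring K ambient" using subfieldE(1)[OF assms] .
  show add: "x \<in> K \<Longrightarrow> y \<in> K \<Longrightarrow> x + y \<in> K" for x y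
    using subringE(7)[OF sr, of x y] by simp
  show "x \<in> K \<Longrightarrow> y \<in> K \<Longrightarrow> x * y \<in> K"
    using subringE(6)[OF sr, of x y] by simp
  show minus: "x \<in> K \<Longrightarrow> - x \<in> K" for x
  proof -
    assume "x \<in> K"
    interpret ring "ambient :: 'a ring" by blast
    have "\<ominus>\<^bsub>ambient\<^esub> x = - x" by (intro minus_equality) auto
    then show ?thesis using subringE(5)[OF sr \<open>x \<in> K\<close>] by simp
  qed
  have one: "1 \<in> K" using subringE(3)[OF sr] by simp
  have zero: "0 \<in> K" using subringE(2)[OF sr] by simp
  show "of_int k \<in> K"
  proof (induction k rule: int_induct[where k = 0])
    case (step2 i)
    then show ?case using add[OF _ minus[OF one]] by fastforce
  qed (use add one zero in auto)
qed

lemma ring_of_integers_closed: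
  fixes K :: "'a::field_char_0 set"
  assumes "subfield K ambient"
  shows "x \<in> ring_of_integers K \<Longrightarrow> y \<in> ring_of_integers K \<Longrightarrow> x + y \<in> ring_of_integers K"
    "x \<in> ring_of_integers K \<Longrightarrow> y \<in> ring_of_integers K \<Longrightarrow> x * y \<in> ring_of_integers K"
    "of_int k \<in> ring_of_integers K"
  unfolding ring_of_integers_def
  by (simp_all add: subfield_closed[OF assms] algebraic_int_add algebraic_int_mult int_imp_algebraic_int)

text \<open>An embedding respects the field operations and the reals form a subfield of the complex
  numbers, so reality spreads from the generators by induction over
  \<open>generate_field\<close>.\<close>

lemma embedding_real_on_generate_field:
  fixes K :: "'a::field_char_0 set"
  assumes \<sigma>: "\<sigma> \<in> embeddings K" and K: "K = generate_field ambient H" "subfield K ambient"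
    and real: "\<And>h. h \<in> H \<Longrightarrow> \<sigma> h \<in> \<real>" and x: "x \<in> K"
  shows "\<sigma> x \<in> \<real>"
proof -
  interpret field "ambient :: 'a ring" by blast
  have add: "\<sigma> (x + y) = \<sigma> x + \<sigma> y" and mult: "\<sigma> (x * y) = \<sigma> x * \<sigma> y" if "x \<in> K" "y \<in> K" for x y
    using \<sigma> that ring_hom_add[of \<sigma> "ambient\<lparr>carrier := K\<rparr>" ambient x y]
      ring_hom_mult[of \<sigma> "ambient\<lparr>carrier := K\<rparr>" ambient x y] by (simp_all add: embeddings_def)
  have one: "\<sigma> 1 = 1"
    using \<sigma> ring_hom_one[of \<sigma> "ambient\<lparr>carrier := K\<rparr>" ambient] by (simp add: embeddings_def)
  have zero: "\<sigma> 0 = 0"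
    using add[of 0 0] subfield_closed(4)[OF K(2), of 0] by simp
  from x have "x \<in> generate_field ambient H" using K(1) by simp
  then show ?thesis
  proof (induction rule: generate_field.induct)
    case (a_inv h)
    \<comment> \<open>Negation and, below, inversion in the record are identified with the type
      class operations by uniqueness of inverses.\<close>
    have "\<ominus>\<^bsub>ambient\<^esub> h = - h" by (intro minus_equality) auto
    moreover have "h \<in> K" using a_inv K(1) by simp
    then have "\<sigma> h + \<sigma> (- h) = 0"
      using add[of h "- h"] subfield_closed(3)[OF K(2)] zero by simp
    then have "\<sigma> (- h) = - \<sigma> h" by (simp add: eq_neg_iff_add_eq_0 add.commute)
    ultimately show ?case using a_inv by simp
  next
    case (m_inv h)
    then have h: "h \<noteq> 0" by simp
    have inv: "inv\<^bsub>ambient\<^esub> h = inverse h"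
      by (rule comm_inv_char) (use h in auto)
    have "h \<in> K" "inverse h \<in> K"
      using m_inv(1) generate_field.m_inv[OF m_inv(1,2)] inv K(1) by simp_all
    then have "\<sigma> h * \<sigma> (inverse h) = 1"
      using mult[of h "inverse h"] h one by simp
    then have "\<sigma> (inverse h) = inverse (\<sigma> h)" by (metis inverse_unique)
    then show ?case using m_inv inv by simp
  next
    case (eng_add h1 h2)
    then show ?case using add[of h1 h2] K(1) by simp
  next
    case (eng_mult h1 h2)
    then show ?case using mult[of h1 h2] K(1) by simp
  qed (use real one in simp_all)
qed

lemma embedding_of_int:
  fixes K :: "'a::field_char_0 set"
  assumes \<sigma>: "\<sigma> \<in> embeddings K" and K: "subfield K ambient"
  shows "\<sigma> (of_int k) = of_int k"
proof -
  have add: "\<sigma> (x + y) = \<sigma> x + \<sigma> y" if "x \<in> K" "y \<in> K" for x y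
    using \<sigma> that ring_hom_add[of \<sigma> "ambient\<lparr>carrier := K\<rparr>" ambient x y] by (simp add: embeddings_def)
  have one: "\<sigma> 1 = 1"
    using \<sigma> ring_hom_one[of \<sigma> "ambient\<lparr>carrier := K\<rparr>" ambient] by (simp add: embeddings_def)
  have in_K: "of_int j \<in> K" for j using subfield_closed(4)[OF K] .
  show ?thesis
  proof (induction k rule: int_induct[where k = 0])
    case base
    show ?case using add[of 0 0] in_K[of 0] by simp
  next
    case (step1 i)
    then show ?case using add[OF in_K[of i] in_K[of 1]] one by simp
  next
    case (step2 i)
    then show ?case using add[OF in_K[of "i - 1"] in_K[of 1]] one by (simp add: algebra_simps)
  qed
qed

lemma complex_square_nonneg_imp_real:
  fixes z :: complex
  assumes "z^2 = of_int a" "a \<ge> 0"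
  shows "z \<in> \<real>"
proof -
  have "z^2 = (of_real (sqrt (of_int a)))^2"
    using assms by (simp flip: of_real_power)
  then have "z = of_real (sqrt (of_int a)) \<or> z = - of_real (sqrt (of_int a))"
    by (simp add: power2_eq_iff)
  then show ?thesis by auto
qed

text \<open>Otherwise every embedding sends both generators to complex square roots of nonnegative
  integers, which are real, and hence maps all of \<open>K\<close> into the reals.\<close>

lemma not_totally_real_imp_negative:
  fixes K :: "'a::field_char_0 set"
  assumes K: "K = generate_field ambient {\<alpha>, \<beta>}" "subfield K ambient" and "\<not> totally_real K"
    and sq: "\<alpha>^2 = of_int a" "\<beta>^2 = of_int b"
  shows "a < 0 \<or> b < 0"
proof (rule ccontr)
  assume nonneg: "\<not> (a < 0 \<or> b < 0)"
  have "\<sigma> ` K \<subseteq> \<real>" if \<sigma>: "\<sigma> \<in> embeddings K" for \<sigma>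
  proof -
    have real: "\<sigma> h \<in> \<real>" if "h \<in> K" "h^2 = of_int k" "k \<ge> 0" for h k
    proof (rule complex_square_nonneg_imp_real)
      have "\<sigma> (h * h) = \<sigma> h * \<sigma> h"
        using \<sigma> that ring_hom_mult[of \<sigma> "ambient\<lparr>carrier := K\<rparr>" ambient h h]
        by (simp add: embeddings_def)
      then show "(\<sigma> h)^2 = of_int k"
        using embedding_of_int[OF \<sigma> K(2), of k] that(2) by (simp add: power2_eq_square)
    qed (fact that)
    have "\<alpha> \<in> K" "\<beta> \<in> K" unfolding K(1) by (auto intro: generate_field.incl)
    then have "\<sigma> h \<in> \<real>" if "h \<in> {\<alpha>, \<beta>}" for h
      using that real sq nonneg by auto
    then show ?thesis using embedding_real_on_generate_field[OF \<sigma> K] by blast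
  qed
  then show False using assms(3) unfolding totally_real_def by blast
qed

subsection \<open>Five squares\<close>

text \<open>The square of a common divisor of the x_i divides \<open>d\<close>, so the x_i are
  coprime. The coefficients come from Bezout for two pairs and then for the two resulting
  gcds.\<close>

lemma squarefree_sum_squares_bezout:
  fixes d :: int
  assumes "squarefree d" "d = x1^2 + x2^2 + x3^2 + x4^2"
  obtains c1 c2 c3 c4 where "c1 * x1 + c2 * x2 + c3 * x3 + c4 * x4 = 1"
proof -
  define g where "g = gcd (gcd x1 x2) (gcd x3 x4)"
  have "g dvd x1" "g dvd x2" "g dvd x3" "g dvd x4"
    unfolding g_def by (meson dvd_trans gcd_dvd1 gcd_dvd2)+
  then have "g^2 dvd d"
    unfolding assms(2) by (intro dvd_add dvd_power_same)
  then have "is_unit g" using assms(1) by (simp add: squarefree_def)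
  then have g: "g = 1" by (simp add: g_def)
  obtain u v where uv: "u * x1 + v * x2 = gcd x1 x2" using bezout_int by blast
  obtain s t where st: "s * x3 + t * x4 = gcd x3 x4" using bezout_int by blast
  obtain e f where ef: "e * gcd x1 x2 + f * gcd x3 x4 = g" using bezout_int unfolding g_def by blast
  have "(e * u) * x1 + (e * v) * x2 + (f * s) * x3 + (f * t) * x4 = 1"
    using ef unfolding g uv[symmetric] st[symmetric] by (simp add: algebra_simps)
  then show thesis using that by blast
qed

text \<open>Expand in powers of g = \<beta> - n: the coefficient of g^2 vanishes by
  \<open>iso\<close>, the linear terms give 4 g by \<open>bez\<close>, and the constant terms give 4
  n.\<close>

lemma four_times_sum_five_squares_identity:
  fixes \<alpha> \<beta> :: "'a::comm_ring_1"
  assumes iso: "\<alpha>^2 + x1^2 + x2^2 + x3^2 + x4^2 = 0"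
    and bez: "c1 * x1 + c2 * x2 + c3 * x3 + c4 * x4 = 1"
    and n: "n = c1^2 + c2^2 + c3^2 + c4^2"
  shows "4 * \<beta> = (\<alpha> * (\<beta> - n))^2 + (x1 * (\<beta> - n) + 2 * c1)^2 + (x2 * (\<beta> - n) + 2 * c2)^2
    + (x3 * (\<beta> - n) + 2 * c3)^2 + (x4 * (\<beta> - n) + 2 * c4)^2"
proof -
  define g where "g = \<beta> - n"
  have sq: "(x * g + 2 * c)^2 = g^2 * x^2 + 4 * g * (c * x) + 4 * c^2" for x c
    by (simp add: power2_eq_square algebra_simps)
  have "(\<alpha> * g)^2 + (x1 * g + 2 * c1)^2 + (x2 * g + 2 * c2)^2 + (x3 * g + 2 * c3)^2 + (x4 * g + 2 * c4)^2
    = g^2 * (\<alpha>^2 + x1^2 + x2^2 + x3^2 + x4^2)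
      + 4 * g * (c1 * x1 + c2 * x2 + c3 * x3 + c4 * x4) + 4 * (c1^2 + c2^2 + c3^2 + c4^2)"
    unfolding sq power_mult_distrib distrib_left by (simp only: ac_simps)
  then show ?thesis
    unfolding iso bez n[symmetric] g_def[symmetric] by (simp add: g_def algebra_simps)
qed

lemma four_times_sum_of_five_squares:
  fixes K :: "'a::field_char_0 set"
  assumes K: "subfield K ambient" and \<alpha>: "\<alpha> \<in> K" "\<alpha>^2 = of_int a" and a: "squarefree a" "a < 0"
    and \<beta>: "\<beta> \<in> ring_of_integers K"
  shows "\<exists>y :: nat \<Rightarrow> 'a. (\<forall>i<5. y i \<in> ring_of_integers K) \<and> 4 * \<beta> = (\<Sum>i<5. (y i)^2)"
proof -
  obtain x1 x2 x3 x4 where x: "- a = x1^2 + x2^2 + x3^2 + x4^2"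
    by (rule lagrange_four_squares[of "- a"]) (use a(2) in auto)
  have "squarefree (- a)" using a(1) by (simp add: squarefree_def)
  then obtain c1 c2 c3 c4 where c: "c1 * x1 + c2 * x2 + c3 * x3 + c4 * x4 = 1"
    using squarefree_sum_squares_bezout x by blast
  define n where "n = c1^2 + c2^2 + c3^2 + c4^2"
  define \<gamma> where "\<gamma> = \<beta> - of_int n"
  \<comment> \<open>The entries of the vector \<beta> l + m of the introduction, with
    \<open>\<gamma>\<close> collecting the coefficient \<beta> - n of l.\<close>
  define ys where "ys = [\<alpha> * \<gamma>, of_int x1 * \<gamma> + of_int (2 * c1), of_int x2 * \<gamma> + of_int (2 * c2),
    of_int x3 * \<gamma> + of_int (2 * c3), of_int x4 * \<gamma> + of_int (2 * c4)]"
  note closed = ring_of_integers_closed[OF K]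
  \<comment> \<open>The monic polynomial X^2 takes the algebraic integer value
    \<open>of_int a\<close> at \<open>\<alpha>\<close>.\<close>
  have "algebraic_int \<alpha>"
    by (rule algebraic_int_root[of "of_int a" "monom 1 2"])
      (use \<alpha>(2) in \<open>auto simp: poly_monom degree_monom_eq intro: int_imp_algebraic_int\<close>)
  then have "\<alpha> \<in> ring_of_integers K" using \<alpha>(1) by (simp add: ring_of_integers_def)
  moreover have "\<gamma> \<in> ring_of_integers K"
    using closed(1)[OF \<beta> closed(3)[of "- n"]] by (simp add: \<gamma>_def)
  ultimately have "set ys \<subseteq> ring_of_integers K"
    unfolding ys_def using closed by (simp del: of_int_mult)
  moreover have "length ys = 5" by (simp add: ys_def)
  ultimately have "\<forall>i<5. ys ! i \<in> ring_of_integers K"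
    by (metis nth_mem subsetD)
  moreover have "4 * \<beta> = (\<Sum>i<5. (ys ! i)^2)"
  proof -
    have "\<alpha>^2 + of_int x1^2 + of_int x2^2 + of_int x3^2 + of_int x4^2 = (0::'a)"
    proof -
      have "a + x1^2 + x2^2 + x3^2 + x4^2 = 0" using x by linarith
      then have "(of_int (a + x1^2 + x2^2 + x3^2 + x4^2) :: 'a) = 0" by (simp only: of_int_0)
      then show ?thesis using \<alpha>(2) by simp
    qed
    moreover have "of_int c1 * of_int x1 + of_int c2 * of_int x2 + of_int c3 * of_int x3
        + of_int c4 * of_int x4 = (1::'a)"
      using arg_cong[OF c, of "of_int :: int \<Rightarrow> 'a"] by simp
    moreover have "of_int n = (of_int c1^2 + of_int c2^2 + of_int c3^2 + of_int c4^2 :: 'a)"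
      by (simp add: n_def)
    ultimately have "4 * \<beta> = (\<alpha> * (\<beta> - of_int n))^2 + (of_int x1 * (\<beta> - of_int n) + 2 * of_int c1)^2
      + (of_int x2 * (\<beta> - of_int n) + 2 * of_int c2)^2 + (of_int x3 * (\<beta> - of_int n) + 2 * of_int c3)^2
      + (of_int x4 * (\<beta> - of_int n) + 2 * of_int c4)^2"
      by (rule four_times_sum_five_squares_identity)
    then show ?thesis
      by (simp add: ys_def \<gamma>_def eval_nat_numeral)
  qed
  ultimately show ?thesis by blast
qed

theorem theorem3:
  fixes K :: "'a::field_char_0 set"
  assumes "complex_biquadratic_field K"
  shows "\<forall>x \<in> {4 * \<beta> | \<beta>. \<beta> \<in> ring_of_integers K}.
    \<exists>y :: nat \<Rightarrow> 'a. (\<forall>i<5. y i \<in> ring_of_integers K) \<and> x = (\<Sum>i<5. (y i)^2)"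
proof -
  \<comment> \<open>Here \<open>\<beta>\<close> is the second generator of \<open>K\<close>, unlike
    the bound \<open>\<beta>\<close> of the statement, which ranges over the ring of
    integers.\<close>
  obtain a b :: int and \<alpha> \<beta> where ab: "squarefree a" "squarefree b"
      "\<alpha>^2 = of_int a" "\<beta>^2 = of_int b" and K: "K = generate_field ambient {\<alpha>, \<beta>}"
    and complex: "\<not> totally_real K"
    using assms unfolding complex_biquadratic_field_def biquadratic_field_def by blast
  have sub: "subfield K ambient"
    unfolding K by (rule field.generate_field_is_subfield) auto
  have "\<alpha> \<in> K" "\<beta> \<in> K" unfolding K by (auto intro: generate_field.incl)
  moreover have "a < 0 \<or> b < 0"
    using not_totally_real_imp_negative[OF K sub complex ab(3,4)] .
  \<comment> \<open>Whichever of \<open>a\<close> and \<open>b\<close> is negative supplies the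
    square root for the isotropic vector; the two cases are symmetric.\<close>
  ultimately show ?thesis
    using four_times_sum_of_five_squares[OF sub] ab by blast
qed

end
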